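(* Let $f=\prod_{i\in I}f_i\in\mathbb{C}\{X,Y\}$, $I=\{1,\ldots,r\}$, $r>1$, with $f_i$ irreducible and $\langle f_i\rangle\neq\langle f_j\rangle$ for $i\neq j$, and let $1<i\leq r$. Then $$\nu_i\left(\mathcal{N}_{[1,i)}\right)=\left\{\nu_i\overline{\left(\frac{\omega\wedge \mathrm{d}f}{\mathrm{d}X\wedge \mathrm{d}Y}\right)};\ \overline{\omega}\in\mathcal{S}_{[1,i)}\right\}.$$ In particular, $\sharp\left(\Delta_i\setminus\nu_i\left(\mathcal{N}_{[1,i)}\right)\right)=\sharp\left(\Lambda_i\setminus\nu_i\left(\mathcal{S}_{[1,i)}\right)\right)$.
   Context: $\mathcal{O}=\mathbb{C}\{X,Y\}/\langle f\rangle$ and $\mathcal{O}_i=\mathbb{C}\{X,Y\}/\langle f_i\rangle$. The normalization of $\mathcal{O}_i$ is identified with a one-variable power series ring in $t_i$, with fraction field $\mathcal{K}_i$, and $\mathcal{O}\subset\prod_{i\in I}\mathcal{O}_i\subset\mathcal{K}=\prod_{i\in I}\mathcal{K}_i$, the total ring of fractions of $\mathcal{O}$; $\pi_i:\mathcal{K}\to\mathcal{K}_i$ is the projection. $\nu_i$ is the $t_i$-adic order on $\mathcal{K}_i$ (with $\nu_i(0)=\infty$), and $\nu_i(z):=\nu_i(\pi_i(z))$ for $z\in\mathcal{K}$. $[1,i)=\{1,\ldots,i-1\}$; $\sharp$ denotes cardinality. Jacobian side: $\mathcal{J}(f)=\{Af_X+Bf_Y;\ A,B\in\mathcal{O}\}\subseteq\mathcal{O}$,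 $\Delta_i=\nu_i(\pi_i(\mathcal{J}(f)))$, and for $L\subseteq I$, $\mathcal{N}_L=\{z\in\mathcal{J}(f):\ \pi_l(z)=0\ \text{for all } l\in L\}$. Differential side: $\Omega^1=\mathbb{C}\{X,Y\}\mathrm{d}X+\mathbb{C}\{X,Y\}\mathrm{d}Y$, $\mathcal{F}(f)=\mathbb{C}\{X,Y\}\cdot\mathrm{d}f+f\cdot\Omega^1$, and $\Omega(\mathcal{O})\simeq\Omega^1/\mathcal{F}(f)$ is the module of Kähler differentials of $\mathcal{O}$, with torsion submodule $\mathcal{T}$ (similarly $\Omega(\mathcal{O}_i)$ and $\mathcal{T}_i$). The quotient $\Omega(\mathcal{O})/\mathcal{T}$ is viewed as a fractional ideal of $\mathcal{O}$ in $\mathcal{K}$ by pulling back to the branches: if $(x_l(t_l),y_l(t_l))$ denotes the image of $(X,Y)$ in the normalization of $\mathcal{O}_l$, the class $\overline{\omega}$ of $\omega=A\,\mathrm{d}X+B\,\mathrm{d}Y$ is identified with the $r$-tuple whose $l$-th component is $t_l\big(A(x_l,y_l)x_l'(t_l)+B(x_l,y_l)y_l'(t_l)\big)$. With this identification $\pi_i(\Omega(\mathcal{O})/\mathcal{T})=\Omega(\mathcal{O}_i)/\mathcal{T}_i$ and $\Lambda_i=\nu_i(\Omega(\mathcal{O}_i)/\mathcal{T}_i)$. For $l\in I$, $\mathcal{S}_l=\frac{\Omega(\mathcal{O})}{\mathcal{T}}\cap\ker\pi_l$, and for $L\subseteq I$, $\mathcal{S}_L=\bigcap_{l\in L}\mathcal{S}_l$.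 For $\omega=A\,\mathrm{d}X+B\,\mathrm{d}Y\in\Omega^1$, $\frac{\omega\wedge\mathrm{d}f}{\mathrm{d}X\wedge\mathrm{d}Y}=Af_Y-Bf_X$, and the overline over it denotes its class in $\mathcal{O}$. *)

theory Defs
  imports
    "HOL-Complex_Analysis.Complex_Analysis"
    "HOL-Library.Extended"
    "HOL-Library.Equipollence"
begin

text \<open>A formal power series in \<open>X, Y\<close> is a power series in \<open>Y\<close> with coefficients in
  \<open>\<complex>[[X]]\<close>; \<open>coeff2 h a b\<close> is the coefficient of \<open>X\<^sup>a Y\<^sup>b\<close>.\<close>

definition coeff2 :: "complex fps fps \<Rightarrow> nat \<Rightarrow> nat \<Rightarrow> complex" where
  "coeff2 h a b = fps_nth (fps_nth h b) a"

definition convergent2 :: "complex fps fps \<Rightarrow> bool" where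
  "convergent2 h \<longleftrightarrow>
     (\<exists>\<rho>>0. (\<lambda>(a, b). norm (coeff2 h a b) * \<rho> ^ (a + b)) summable_on UNIV)"

lemma coeff2_simps [simp]:
  "coeff2 0 a b = 0" "coeff2 (g + h) a b = coeff2 g a b + coeff2 h a b"
  "coeff2 (- g) a b = - coeff2 g a b" "coeff2 (g - h) a b = coeff2 g a b - coeff2 h a b"
  "coeff2 1 a b = (if a = 0 \<and> b = 0 then 1 else 0)"
  by (auto simp: coeff2_def)

lemma coeff2_mult:
  "coeff2 (g * h) a b = (\<Sum>j=0..b. \<Sum>i=0..a. coeff2 g i j * coeff2 h (a - i) (b - j))"
  by (simp add: coeff2_def fps_mult_nth fps_sum_nth)

lemma convergent2I:
  assumes "R > 0" and bd: "\<And>a b. norm (coeff2 h a b) \<le> C * R ^ (a + b)"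
  shows "convergent2 h"
proof -
  define \<rho> where "\<rho> = 1 / (2 * R)"
  have rho: "\<rho> > 0" "R * \<rho> = 1 / 2" using assms(1) by (auto simp: \<rho>_def)
  have C: "C \<ge> 0" using order_trans[OF norm_ge_zero bd[of 0 0]] by simp
  have geo: "(\<lambda>n. (1/2::real) ^ n) summable_on UNIV"
    by (rule summable_nonneg_imp_summable_on) (simp_all add: summable_geometric)
  have "(\<lambda>(a, b). (1/2::real) ^ a * (1/2) ^ b) summable_on UNIV \<times> UNIV"
  proof (rule summable_on_SigmaI)
    show "((\<lambda>b. case (a, b) of (a, b) \<Rightarrow> (1/2::real) ^ a * (1/2) ^ b)
        has_sum ((1/2) ^ a * infsum (\<lambda>b. (1/2::real) ^ b) UNIV)) UNIV" for a
      unfolding prod.case by (intro has_sum_cmult_right has_sum_infsum geo)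
    show "(\<lambda>a. (1/2::real) ^ a * infsum (\<lambda>b. (1/2::real) ^ b) UNIV) summable_on UNIV"
      by (intro summable_on_cmult_left geo)
  qed simp
  then have s: "(\<lambda>p. C * (case p of (a, b) \<Rightarrow> (1/2::real) ^ a * (1/2) ^ b)) summable_on UNIV"
    by (intro summable_on_cmult_right) simp
  have "(\<lambda>(a, b). norm (coeff2 h a b) * \<rho> ^ (a + b)) summable_on UNIV"
  proof (rule summable_on_comparison_test[OF s])
    fix p :: "nat \<times> nat"
    obtain a b where p: "p = (a, b)" by force
    have "norm (coeff2 h a b) * \<rho> ^ (a + b) \<le> C * R ^ (a + b) * \<rho> ^ (a + b)"
      by (rule mult_right_mono[OF bd]) (use rho(1) in simp)
    also have "\<dots> = C * (R * \<rho>) ^ (a + b)" by (simp add: power_mult_distrib)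
    finally show "(case p of (a, b) \<Rightarrow> norm (coeff2 h a b) * \<rho> ^ (a + b))
        \<le> C * (case p of (a, b) \<Rightarrow> (1/2) ^ a * (1/2) ^ b)"
      unfolding p prod.case rho(2) power_add .
  qed (use rho(1) in \<open>simp add: case_prod_beta\<close>)
  then show ?thesis unfolding convergent2_def using rho by blast
qed

lemma convergent2E:
  assumes "convergent2 h"
  obtains C R where "C \<ge> 0" "R > 0" "\<And>a b. norm (coeff2 h a b) \<le> C * R ^ (a + b)"
proof -
  obtain \<rho> where rho: "\<rho> > 0"
    and s: "(\<lambda>(a, b). norm (coeff2 h a b) * \<rho> ^ (a + b)) summable_on UNIV"
    using assms convergent2_def by blast
  let ?g = "\<lambda>(a, b). norm (coeff2 h a b) * \<rho> ^ (a + b)"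
  define C where "C = infsum ?g UNIV"
  have C: "C \<ge> 0" unfolding C_def by (rule infsum_nonneg) (use rho in auto)
  have "norm (coeff2 h a b) \<le> C * (1 / \<rho>) ^ (a + b)" for a b
  proof -
    have "infsum ?g {(a, b)} \<le> C" unfolding C_def
      by (rule infsum_mono2) (use s rho in auto)
    then have "norm (coeff2 h a b) * \<rho> ^ (a + b) \<le> C" by simp
    then show ?thesis using rho by (simp add: field_simps power_divide)
  qed
  then show ?thesis using that[of C "1 / \<rho>"] C rho by simp
qed

lemma convergent2_common:
  assumes "convergent2 g" "convergent2 h"
  obtains C R where "C \<ge> 0" "R \<ge> 1" "\<And>a b. norm (coeff2 g a b) \<le> C * R ^ (a + b)"
    "\<And>a b. norm (coeff2 h a b) \<le> C * R ^ (a + b)"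
proof -
  obtain C R where 1: "C \<ge> 0" "R > 0" "\<And>a b. norm (coeff2 g a b) \<le> C * R ^ (a + b)"
    using convergent2E[OF assms(1)] by blast
  obtain D S where 2: "D \<ge> 0" "S > 0" "\<And>a b. norm (coeff2 h a b) \<le> D * S ^ (a + b)"
    using convergent2E[OF assms(2)] by blast
  define T where "T = max 1 (max R S)"
  have *: "C * R ^ n \<le> max C D * T ^ n" "D * S ^ n \<le> max C D * T ^ n" for n
    by (rule mult_mono; use 1(1,2) 2(1,2) in \<open>simp add: T_def power_mono\<close>)+
  show ?thesis
  proof (rule that[of "max C D" T])
    show "max C D \<ge> 0" "T \<ge> 1" using 1 by (auto simp: T_def)
    show "norm (coeff2 g a b) \<le> max C D * T ^ (a + b)" for a b
      using 1(3)[of a b] *(1)[of "a + b"] by linarith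
    show "norm (coeff2 h a b) \<le> max C D * T ^ (a + b)" for a b
      using 2(3)[of a b] *(2)[of "a + b"] by linarith
  qed
qed

lemma convergent2_add:
  assumes "convergent2 g" "convergent2 h" shows "convergent2 (g + h)"
proof -
  obtain C R where *: "C \<ge> 0" "R \<ge> 1" "\<And>a b. norm (coeff2 g a b) \<le> C * R ^ (a + b)"
    "\<And>a b. norm (coeff2 h a b) \<le> C * R ^ (a + b)"
    using convergent2_common[OF assms] by blast
  show ?thesis
  proof (rule convergent2I[of R _ "2 * C"])
    fix a b
    show "norm (coeff2 (g + h) a b) \<le> 2 * C * R ^ (a + b)"
      using *(3,4)[of a b] norm_triangle_ineq[of "coeff2 g a b" "coeff2 h a b"] by simp
  qed (use *(1,2) in simp_all)
qed

lemma convergent2_uminus: "convergent2 g \<Longrightarrow> convergent2 (- g)"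
  by (simp add: convergent2_def)

lemma convergent2_0: "convergent2 0"
  by (rule convergent2I[of 1 _ 0]) auto

lemma convergent2_1: "convergent2 1"
  by (rule convergent2I[of 1 _ 1]) auto

lemma Suc_le_two_power: "real (Suc n) \<le> 2 ^ n"
  by (induction n) auto

lemma convergent2_mult:
  assumes "convergent2 g" "convergent2 h" shows "convergent2 (g * h)"
proof -
  obtain C R where *: "C \<ge> 0" "R \<ge> 1" "\<And>a b. norm (coeff2 g a b) \<le> C * R ^ (a + b)"
    "\<And>a b. norm (coeff2 h a b) \<le> C * R ^ (a + b)"
    using convergent2_common[OF assms] by blast
  show ?thesis
  proof (rule convergent2I[of "2 * R" _ "C * C"])
    fix a b
    have "norm (coeff2 (g * h) a b) \<le> (\<Sum>j=0..b. \<Sum>i=0..a. C * C * R ^ (a + b))"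
      unfolding coeff2_mult
    proof (intro sum_norm_le)
      fix j i assume ij: "j \<in> {0..b}" "i \<in> {0..a}"
      have "norm (coeff2 g i j * coeff2 h (a - i) (b - j))
          \<le> (C * R ^ (i + j)) * (C * R ^ ((a - i) + (b - j)))"
        unfolding norm_mult using * by (intro mult_mono mult_nonneg_nonneg) simp_all
      also have "\<dots> = C * C * R ^ ((i + j) + ((a - i) + (b - j)))" by (simp add: power_add)
      also have "(i + j) + ((a - i) + (b - j)) = a + b" using ij by auto
      finally show "norm (coeff2 g i j * coeff2 h (a - i) (b - j)) \<le> C * C * R ^ (a + b)" .
    qed
    also have "\<dots> = (real (Suc b) * real (Suc a)) * (C * C * R ^ (a + b))" by simp
    also have "\<dots> \<le> (2 ^ b * 2 ^ a) * (C * C * R ^ (a + b))"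
      using * by (intro mult_right_mono mult_mono Suc_le_two_power) auto
    also have "\<dots> = C * C * (2 * R) ^ (a + b)" by (simp add: power_add power_mult_distrib)
    finally show "norm (coeff2 (g * h) a b) \<le> C * C * (2 * R) ^ (a + b)" .
  qed (use *(1,2) in simp_all)
qed

typedef cps2 = "{h :: complex fps fps. convergent2 h}"
  morphisms series Abs_cps2
  using convergent2_0 by blast

setup_lifting type_definition_cps2

instantiation cps2 :: idom
begin
lift_definition zero_cps2 :: cps2 is 0 by (rule convergent2_0)
lift_definition one_cps2 :: cps2 is 1 by (rule convergent2_1)
lift_definition plus_cps2 :: "cps2 \<Rightarrow> cps2 \<Rightarrow> cps2" is "(+)" by (rule convergent2_add)
lift_definition uminus_cps2 :: "cps2 \<Rightarrow> cps2" is uminus by (rule convergent2_uminus)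
lift_definition minus_cps2 :: "cps2 \<Rightarrow> cps2 \<Rightarrow> cps2" is "(-)"
  using convergent2_add convergent2_uminus by fastforce
lift_definition times_cps2 :: "cps2 \<Rightarrow> cps2 \<Rightarrow> cps2" is "(*)" by (rule convergent2_mult)
instance
proof
  fix a b c :: cps2
  show "a * b * c = a * (b * c)" by transfer (rule mult.assoc)
  show "a * b = b * a" by transfer (rule mult.commute)
  show "1 * a = a" by transfer (rule mult_1_left)
  show "a + b + c = a + (b + c)" by transfer (rule add.assoc)
  show "a + b = b + a" by transfer (rule add.commute)
  show "0 + a = a" by transfer (rule add_0)
  show "- a + a = 0" by transfer (rule left_minus)
  show "a - b = a + - b" by transfer (rule diff_conv_add_uminus)
  show "0 * a = 0" by transfer (rule mult_zero_left)
  show "a * 0 = 0" by transfer (rule mult_zero_right)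
  show "a * (b + c) = a * b + a * c" by transfer (rule distrib_left)
  show "(a + b) * c = a * c + b * c" by transfer (rule distrib_right)
  show "(0 :: cps2) \<noteq> 1" by transfer (rule zero_neq_one)
  show "a \<noteq> 0 \<Longrightarrow> b \<noteq> 0 \<Longrightarrow> a * b \<noteq> 0" by transfer (rule no_zero_divisors)
qed
end

lift_definition diff_X :: "cps2 \<Rightarrow> cps2" is "\<lambda>h. Abs_fps (\<lambda>b. fps_deriv (fps_nth h b))"
proof -
  fix h :: "complex fps fps" assume "convergent2 h"
  then obtain C R where *: "C \<ge> 0" "R > 0" "\<And>a b. norm (coeff2 h a b) \<le> C * R ^ (a + b)"
    using convergent2E by blast
  show "convergent2 (Abs_fps (\<lambda>b. fps_deriv (fps_nth h b)))"
  proof (rule convergent2I[of "2 * R" _ "C * R"])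
    fix a b
    have "norm (coeff2 (Abs_fps (\<lambda>b. fps_deriv (fps_nth h b))) a b)
        = real (Suc a) * norm (coeff2 h (Suc a) b)"
      unfolding coeff2_def by (simp add: norm_mult del: of_nat_Suc)
    also have "\<dots> \<le> 2 ^ (a + b) * (C * R ^ (Suc a + b))"
      by (rule mult_mono[OF order_trans[OF Suc_le_two_power power_increasing] *(3)[of "Suc a" b]]) simp_all
    finally show "norm (coeff2 (Abs_fps (\<lambda>b. fps_deriv (fps_nth h b))) a b)
        \<le> C * R * (2 * R) ^ (a + b)"
      by (simp add: power_mult_distrib algebra_simps)
  qed (use *(1,2) in simp_all)
qed

lift_definition diff_Y :: "cps2 \<Rightarrow> cps2" is fps_deriv
proof -
  fix h :: "complex fps fps" assume "convergent2 h"
  then obtain C R where *: "C \<ge> 0" "R > 0" "\<And>a b. norm (coeff2 h a b) \<le> C * R ^ (a + b)"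
    using convergent2E by blast
  show "convergent2 (fps_deriv h)"
  proof (rule convergent2I[of "2 * R" _ "C * R"])
    fix a b
    have "fps_nth (of_nat (Suc b) * fps_nth h (Suc b)) a = of_nat (Suc b) * coeff2 h a (Suc b)"
      unfolding coeff2_def fps_of_nat[symmetric] fps_mult_left_const_nth by simp
    then have "norm (coeff2 (fps_deriv h) a b) = real (Suc b) * norm (coeff2 h a (Suc b))"
      unfolding coeff2_def fps_deriv_nth Suc_eq_plus1[symmetric]
      by (simp add: norm_mult del: of_nat_Suc)
    also have "\<dots> \<le> 2 ^ (a + b) * (C * R ^ (a + Suc b))"
      by (rule mult_mono[OF order_trans[OF Suc_le_two_power power_increasing] *(3)[of a "Suc b"]]) simp_all
    finally show "norm (coeff2 (fps_deriv h) a b) \<le> C * R * (2 * R) ^ (a + b)"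
      by (simp add: power_mult_distrib algebra_simps)
  qed (use *(1,2) in simp_all)
qed

text \<open>\<open>substitute h x y\<close> is \<open>h(x(t), y(t))\<close>. It is meaningful only if \<open>x\<close> and \<open>y\<close> have no constant
  term; then \<open>x\<^sup>a y\<^sup>b\<close> has order at least \<open>a + b\<close>, and the coefficient of \<open>t\<^sup>n\<close> only
  involves the monomials with \<open>a, b \<le> n\<close>.\<close>

definition substitute :: "cps2 \<Rightarrow> complex fps \<Rightarrow> complex fps \<Rightarrow> complex fps" where
  "substitute h x y = Abs_fps (\<lambda>n. \<Sum>a\<le>n. \<Sum>b\<le>n. coeff2 (series h) a b * fps_nth (x ^ a * y ^ b) n)"

definition convergent_series :: "complex fps set" where
  "convergent_series = {p. fps_conv_radius p > 0}"

definition fraction_field_in :: "complex fls set \<Rightarrow> complex fls set" where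
  "fraction_field_in R = {p / q |p q. p \<in> R \<and> q \<in> R \<and> q \<noteq> 0}"

definition integral_over :: "complex fls set \<Rightarrow> complex fls \<Rightarrow> bool" where
  "integral_over R z \<longleftrightarrow>
     (\<exists>p. lead_coeff p = 1 \<and> (\<forall>n. coeff p n \<in> R) \<and> poly p z = 0)"

definition principal_ideal :: "cps2 \<Rightarrow> cps2 set" where
  "principal_ideal f = {h * f |h. True}"

text \<open>\<open>(x(t), y(t))\<close> is the image of \<open>(X, Y)\<close> under an identification of the normalization of
  \<open>\<complex>{X,Y}/\<langle>f\<rangle>\<close> with \<open>\<complex>{t}\<close>: substitution has kernel \<open>\<langle>f\<rangle>\<close>, hence embeds
  \<open>\<complex>{X,Y}/\<langle>f\<rangle>\<close> into \<open>\<complex>{t}\<close>, and \<open>\<complex>{t}\<close> is the integral closure of its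
  image \<open>R\<close> in the fraction field of \<open>R\<close>. Fields of fractions are formed inside \<open>\<complex>((t))\<close>.\<close>

definition normalization_by :: "cps2 \<Rightarrow> complex fps \<Rightarrow> complex fps \<Rightarrow> bool" where
  "normalization_by f x y \<longleftrightarrow>
     x \<in> convergent_series \<and> y \<in> convergent_series \<and> fps_nth x 0 = 0 \<and> fps_nth y 0 = 0 \<and>
     {h. substitute h x y = 0} = principal_ideal f \<and>
     (let R = range (\<lambda>h. fps_to_fls (substitute h x y))
      in {z \<in> fraction_field_in R. integral_over R z} = fps_to_fls ` convergent_series)"

definition t_order :: "complex fls \<Rightarrow> int extended" where
  "t_order z = (if z = 0 then Pinf else Fin (fls_subdegree z))"

text \<open>The map induced by \<open>\<phi>\<close> on a quotient whose elements are cosets on which \<open>\<phi>\<close> is constant.\<close>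

definition induced :: "('a \<Rightarrow> 'b) \<Rightarrow> 'a set \<Rightarrow> 'b" where
  "induced \<phi> c = the_elem (\<phi> ` c)"

text \<open>The elements of \<open>\<O> = \<complex>{X,Y}/\<langle>f\<rangle>\<close> are the cosets \<open>class_O f h = h + \<langle>f\<rangle>\<close>.\<close>

definition class_O :: "cps2 \<Rightarrow> cps2 \<Rightarrow> cps2 set" where
  "class_O f h = {g. g - h \<in> principal_ideal f}"

text \<open>The embedding of \<open>\<O>\<close> into \<open>\<K>\<close>. Elements of \<open>\<K>\<close> are families \<open>z\<close> indexed by the
  branches, so \<open>\<pi>\<^sub>i(z)\<close> is \<open>z i\<close>.\<close>

definition emb_O :: "(nat \<Rightarrow> complex fps) \<Rightarrow> (nat \<Rightarrow> complex fps) \<Rightarrow> cps2 set \<Rightarrow> nat \<Rightarrow> complex fls"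
  where "emb_O x y c = (\<lambda>i. induced (\<lambda>h. fps_to_fls (substitute h (x i) (y i))) c)"

definition Jac :: "cps2 \<Rightarrow> cps2 set set" where
  "Jac f = {class_O f (A * diff_X f + B * diff_Y f) |A B. True}"

definition Delta :: "cps2 \<Rightarrow> (nat \<Rightarrow> complex fps) \<Rightarrow> (nat \<Rightarrow> complex fps) \<Rightarrow> nat \<Rightarrow> int extended set"
  where "Delta f x y i = (\<lambda>z. t_order (emb_O x y z i)) ` Jac f"

definition N_sub ::
  "cps2 \<Rightarrow> (nat \<Rightarrow> complex fps) \<Rightarrow> (nat \<Rightarrow> complex fps) \<Rightarrow> nat set \<Rightarrow> cps2 set set"
  where "N_sub f x y L = {z \<in> Jac f. \<forall>l\<in>L. emb_O x y z l = 0}"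

text \<open>The pair \<open>(A, B)\<close> stands for \<open>A dX + B dY\<close>.\<close>

type_synonym form = "cps2 \<times> cps2"

definition smult_form :: "cps2 \<Rightarrow> form \<Rightarrow> form" where
  "smult_form h \<omega> = (h * fst \<omega>, h * snd \<omega>)"

definition total_diff :: "cps2 \<Rightarrow> form" where
  "total_diff f = (diff_X f, diff_Y f)"

definition F_sub :: "cps2 \<Rightarrow> form set" where
  "F_sub f = {smult_form h (total_diff f) + smult_form f \<eta> |h \<eta>. True}"

text \<open>The class of \<open>\<omega>\<close> in \<open>\<Omega>(\<O>) = \<Omega>\<^sup>1/\<F>(f)\<close>.\<close>

definition class_Omega :: "cps2 \<Rightarrow> form \<Rightarrow> form set" where
  "class_Omega f \<omega> = {\<eta>. \<eta> - \<omega> \<in> F_sub f}"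

definition regular_mod :: "cps2 \<Rightarrow> cps2 \<Rightarrow> bool" where
  "regular_mod f h \<longleftrightarrow> (\<forall>g. class_O f (h * g) = class_O f 0 \<longrightarrow> class_O f g = class_O f 0)"

text \<open>The torsion submodule: elements of \<open>\<Omega>(\<O>)\<close> killed by a non-zero-divisor of \<open>\<O>\<close>.\<close>

definition torsion :: "cps2 \<Rightarrow> form set set" where
  "torsion f = {class_Omega f \<omega> |\<omega>.
     \<exists>h. regular_mod f h \<and> class_Omega f (smult_form h \<omega>) = class_Omega f 0}"

text \<open>The class of \<open>\<omega>\<close> in \<open>\<Omega>(\<O>)/\<T>\<close>, as a set of differential forms.\<close>

definition bar :: "cps2 \<Rightarrow> form \<Rightarrow> form set" where
  "bar f \<omega> = {\<eta>. class_Omega f (\<eta> - \<omega>) \<in> torsion f}"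

definition Omega_mod_torsion :: "cps2 \<Rightarrow> form set set" where
  "Omega_mod_torsion f = range (bar f)"

definition pullback :: "complex fps \<Rightarrow> complex fps \<Rightarrow> form \<Rightarrow> complex fls" where
  "pullback x y \<omega> =
     fps_to_fls (fps_X * (substitute (fst \<omega>) x y * fps_deriv x + substitute (snd \<omega>) x y * fps_deriv y))"

text \<open>The \<open>i\<close>-th component of \<open>emb_Omega\<close> is induced by pulling back to the \<open>i\<close>-th branch and
  multiplying by \<open>t\<^sub>i\<close> (the factor \<open>fps_X\<close> above); this is the identification of \<open>\<Omega>(\<O>)/\<T>\<close> with a
  fractional ideal in \<open>\<K>\<close>.\<close>

definition emb_Omega ::
  "(nat \<Rightarrow> complex fps) \<Rightarrow> (nat \<Rightarrow> complex fps) \<Rightarrow> form set \<Rightarrow> nat \<Rightarrow> complex fls"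
  where "emb_Omega x y c = (\<lambda>i. induced (pullback (x i) (y i)) c)"

text \<open>To be used with \<open>g = f\<^sub>i\<close> and the normalization \<open>(x, y)\<close> of the branch \<open>f\<^sub>i\<close>.\<close>

definition Lambda :: "cps2 \<Rightarrow> complex fps \<Rightarrow> complex fps \<Rightarrow> int extended set" where
  "Lambda g x y = (\<lambda>c. t_order (induced (pullback x y) c)) ` Omega_mod_torsion g"

definition S_branch ::
  "cps2 \<Rightarrow> (nat \<Rightarrow> complex fps) \<Rightarrow> (nat \<Rightarrow> complex fps) \<Rightarrow> nat \<Rightarrow> form set set"
  where "S_branch f x y l = {c \<in> Omega_mod_torsion f. emb_Omega x y c l = 0}"

definition S_sub ::
  "cps2 \<Rightarrow> (nat \<Rightarrow> complex fps) \<Rightarrow> (nat \<Rightarrow> complex fps) \<Rightarrow> nat set \<Rightarrow> form set set"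
  where "S_sub f x y L = (\<Inter>l\<in>L. S_branch f x y l)"

text \<open>The coefficient of \<open>\<omega> \<and> df\<close> with respect to \<open>dX \<and> dY\<close>.\<close>

definition wedge_quot :: "form \<Rightarrow> cps2 \<Rightarrow> cps2" where
  "wedge_quot \<omega> f = fst \<omega> * diff_Y f - snd \<omega> * diff_X f"

end

theory Submission
  imports Defs
begin

text \<open>On each branch \<open>f(x\<^sub>l, y\<^sub>l) = 0\<close>, so \<open>f\<^sub>X x\<^sub>l' + f\<^sub>Y y\<^sub>l' = 0\<close> and the vector \<open>(f\<^sub>Y, -f\<^sub>X)\<close> is a
  multiple of \<open>(t\<^sub>l x\<^sub>l', t\<^sub>l y\<^sub>l')\<close> by some \<open>c\<^sub>l\<close> in \<open>\<K>\<^sub>l\<close>, which is nonzero because \<open>f\<close> is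
  reduced. Hence \<open>A f\<^sub>Y - B f\<^sub>X\<close> is \<open>c\<^sub>l\<close> times the pullback of \<open>A dX + B dY\<close>, for all \<open>A\<close> and \<open>B\<close>
  at once: both vanish on the same branches, and their orders on the \<open>i\<close>-th branch differ by the
  fixed integer \<open>\<nu>\<^sub>i(c\<^sub>i)\<close>.\<close>

subsection \<open>Substitution is a ring homomorphism satisfying the chain rule\<close>

text \<open>Both series are divisible by \<open>fps_X\<close>, hence the monomial by
  \<open>fps_X ^ (a + b)\<close>. This lets the summation ranges below be enlarged without changing
  the coefficient.\<close>

lemma fps_power_mult_power_nth_eq_0:
  fixes x y :: "'a::comm_ring_1 fps"
  assumes "fps_nth x 0 = 0" "fps_nth y 0 = 0" "n < a + b"
  shows "fps_nth (x ^ a * y ^ b) n = 0"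
proof -
  have "fps_X dvd z" if "fps_nth z 0 = 0" for z :: "'a fps"
  proof -
    have "z = fps_shift 1 z * fps_X"
      using that by (intro fps_ext) simp
    then show ?thesis by (rule dvdI[OF trans[OF _ mult.commute]])
  qed
  then have "fps_X dvd x" "fps_X dvd y" using assms by blast+
  then have "fps_X ^ (a + b) dvd x ^ a * y ^ b"
    unfolding power_add by (intro mult_dvd_mono dvd_power_same)
  then obtain z where "x ^ a * y ^ b = fps_X ^ (a + b) * z" ..
  then show ?thesis using assms(3) by (simp add: fps_X_power_mult_nth)
qed

text \<open>The triangle lies in the square and \<open>\<phi>\<close> vanishes on the rest. It
  replaces the dependent ranges of a convolution by independent ones.\<close>

lemma sum_triangle_eq_square:
  fixes \<phi> :: "nat \<Rightarrow> nat \<Rightarrow> 'a::comm_monoid_add"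
  assumes "\<And>i k. n < i + k \<Longrightarrow> \<phi> i k = 0"
  shows "(\<Sum>a\<le>n. \<Sum>i\<le>a. \<phi> i (a - i)) = (\<Sum>i\<le>n. \<Sum>k\<le>n. \<phi> i k)"
proof -
  have "(\<Sum>a\<le>n. \<Sum>i\<le>a. \<phi> i (a - i)) = sum (\<lambda>(i, k). \<phi> i k) {(i, k). i + k \<le> n}"
    by (rule sum.triangle_reindex_eq[symmetric])
  also have "\<dots> = sum (\<lambda>(i, k). \<phi> i k) ({..n} \<times> {..n})"
    by (rule sum.mono_neutral_left) (auto intro!: assms)
  finally show ?thesis by (simp add: sum.cartesian_product)
qed

text \<open>A finite sum, so that products and derivatives can be expanded termwise. The two bounds
  are separate because a partial derivative lowers only one of the exponents.\<close>

definition truncated_substitute ::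
  "nat \<Rightarrow> nat \<Rightarrow> cps2 \<Rightarrow> complex fps \<Rightarrow> complex fps \<Rightarrow> complex fps" where
  "truncated_substitute M N h x y =
     (\<Sum>a\<le>M. \<Sum>b\<le>N. fps_const (coeff2 (series h) a b) * (x ^ a * y ^ b))"

lemma substitute_nth_truncated:
  assumes "fps_nth x 0 = 0" "fps_nth y 0 = 0" "n \<le> M" "n \<le> N"
  shows "fps_nth (substitute h x y) n = fps_nth (truncated_substitute M N h x y) n"
proof -
  let ?g = "\<lambda>a b. coeff2 (series h) a b * fps_nth (x ^ a * y ^ b) n"
  have "(\<Sum>a\<le>n. \<Sum>b\<le>n. ?g a b) = (\<Sum>(a, b)\<in>{..n} \<times> {..n}. ?g a b)"
    by (simp add: sum.cartesian_product)
  also have "\<dots> = (\<Sum>(a, b)\<in>{..M} \<times> {..N}. ?g a b)"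
    by (rule sum.mono_neutral_left)
      (use assms in \<open>auto intro!: fps_power_mult_power_nth_eq_0\<close>)
  also have "\<dots> = (\<Sum>a\<le>M. \<Sum>b\<le>N. ?g a b)"
    by (simp add: sum.cartesian_product)
  finally show ?thesis
    by (simp add: substitute_def truncated_substitute_def fps_sum_nth)
qed

lemma substitute_0 [simp]: "substitute 0 x y = 0"
  by (simp add: substitute_def zero_cps2.rep_eq fps_eq_iff)

lemma substitute_add: "substitute (g + h) x y = substitute g x y + substitute h x y"
  by (simp add: substitute_def plus_cps2.rep_eq fps_eq_iff sum.distrib distrib_right)

lemma substitute_diff: "substitute (g - h) x y = substitute g x y - substitute h x y"
  by (simp add: substitute_def minus_cps2.rep_eq fps_eq_iff sum_subtractf left_diff_distrib)

lemma substitute_1: "substitute 1 x y = 1"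
proof (rule fps_ext)
  fix n
  show "fps_nth (substitute 1 x y) n = fps_nth 1 n"
    by (cases n) (auto simp: substitute_def one_cps2.rep_eq intro!: sum.neutral)
qed

lemma substitute_nth_0: "fps_nth (substitute h x y) 0 = coeff2 (series h) 0 0"
  by (simp add: substitute_def)

lemma substitute_0_0: "substitute h 0 0 = fps_const (coeff2 (series h) 0 0)"
proof (rule fps_ext)
  fix n
  show "fps_nth (substitute h 0 0) n = fps_nth (fps_const (coeff2 (series h) 0 0)) n"
    by (cases n) (auto simp: substitute_def power_0_left intro!: sum.neutral)
qed

text \<open>The Cauchy product in both variables is regrouped by the exponents of the two factors.
  Monomials of total degree above \<open>n\<close> do not reach the coefficient of index
  \<open>n\<close>, so all ranges may end at \<open>n\<close>.\<close>

lemma substitute_mult: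
  assumes "fps_nth x 0 = 0" "fps_nth y 0 = 0"
  shows "substitute (g * h) x y = substitute g x y * substitute h x y"
proof (rule fps_ext)
  fix n
  let ?c = "coeff2 (series g)" and ?d = "coeff2 (series h)"
  let ?m = "\<lambda>a b. fps_nth (x ^ a * y ^ b) n"
  have m: "?m a b = 0" if "n < a + b" for a b
    using assms that by (rule fps_power_mult_power_nth_eq_0)
  have "fps_nth (substitute (g * h) x y) n
      = (\<Sum>a\<le>n. \<Sum>b\<le>n. (\<Sum>j\<le>b. \<Sum>i\<le>a. ?c i j * ?d (a - i) (b - j)) * ?m a b)"
    unfolding substitute_def times_cps2.rep_eq coeff2_mult by (simp add: atMost_atLeast0)
  \<comment> \<open>Writing \<open>b\<close> as \<open>j + (b - j)\<close> exhibits the summand as a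
    function of \<open>j\<close> and \<open>b - j\<close>, the form that
    \<open>sum_triangle_eq_square\<close> requires; \<open>a\<close> is treated likewise further
    down.\<close>
  also have "\<dots> = (\<Sum>a\<le>n. \<Sum>b\<le>n. \<Sum>j\<le>b. \<Sum>i\<le>a. ?c i j * ?d (a - i) (b - j) * ?m a (j + (b - j)))"
    by (simp add: sum_distrib_right)
  also have "\<dots> = (\<Sum>a\<le>n. \<Sum>j\<le>n. \<Sum>l\<le>n. \<Sum>i\<le>a. ?c i j * ?d (a - i) l * ?m a (j + l))"
    by (intro sum.cong refl sum_triangle_eq_square) (auto simp: m)
  also have "\<dots> = (\<Sum>a\<le>n. \<Sum>j\<le>n. \<Sum>i\<le>a. \<Sum>l\<le>n. ?c i j * ?d (a - i) l * ?m a (j + l))"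
    by (rule sum.cong[OF refl], rule sum.cong[OF refl], rule sum.swap)
  also have "\<dots> = (\<Sum>a\<le>n. \<Sum>i\<le>a. \<Sum>j\<le>n. \<Sum>l\<le>n. ?c i j * ?d (a - i) l * ?m a (j + l))"
    by (rule sum.cong[OF refl], rule sum.swap)
  also have "\<dots> = (\<Sum>a\<le>n. \<Sum>i\<le>a. \<Sum>j\<le>n. \<Sum>l\<le>n. ?c i j * ?d (a - i) l * ?m (i + (a - i)) (j + l))"
    by simp
  also have "\<dots> = (\<Sum>i\<le>n. \<Sum>k\<le>n. \<Sum>j\<le>n. \<Sum>l\<le>n. ?c i j * ?d k l * ?m (i + k) (j + l))"
    by (rule sum_triangle_eq_square) (auto simp: m intro!: sum.neutral)
  also have "\<dots> = (\<Sum>i\<le>n. \<Sum>j\<le>n. \<Sum>k\<le>n. \<Sum>l\<le>n. ?c i j * ?d k l * ?m (i + k) (j + l))"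
    by (rule sum.cong[OF refl], rule sum.swap)
  also have "\<dots> = fps_nth (truncated_substitute n n g x y * truncated_substitute n n h x y) n"
  proof -
    have "fps_const (?c i j) * (x ^ i * y ^ j) * (fps_const (?d k l) * (x ^ k * y ^ l))
        = fps_const (?c i j * ?d k l) * (x ^ (i + k) * y ^ (j + l))" for i j k l
      by (simp add: power_add mult_ac flip: fps_const_mult)
    then have "truncated_substitute n n g x y * truncated_substitute n n h x y
        = (\<Sum>i\<le>n. \<Sum>j\<le>n. \<Sum>k\<le>n. \<Sum>l\<le>n.
            fps_const (?c i j * ?d k l) * (x ^ (i + k) * y ^ (j + l)))"
      unfolding truncated_substitute_def sum_distrib_right unfolding sum_distrib_left by simp
    then show ?thesis by (simp add: fps_sum_nth)
  qed
  \<comment> \<open>The coefficient of index \<open>n\<close> of a product involves only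
    coefficients of index at most \<open>n\<close> of its factors, where truncation changes
    nothing.\<close>
  also have "\<dots> = fps_nth (substitute g x y * substitute h x y) n"
    unfolding fps_mult_nth
    by (intro sum.cong refl arg_cong2[of _ _ _ _ "(*)"] substitute_nth_truncated[symmetric] assms) auto
  finally show "fps_nth (substitute (g * h) x y) n = fps_nth (substitute g x y * substitute h x y) n" .
qed

lemma substitute_prod:
  assumes "fps_nth x 0 = 0" "fps_nth y 0 = 0"
  shows "substitute (\<Prod>j\<in>J. h j) x y = (\<Prod>j\<in>J. substitute (h j) x y)"
  by (induction J rule: infinite_finite_induct) (simp_all add: substitute_1 substitute_mult[OF assms])

lemma coeff2_diff_X: "coeff2 (series (diff_X h)) a b = of_nat (Suc a) * coeff2 (series h) (Suc a) b"
  by (simp add: diff_X.rep_eq coeff2_def)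

lemma coeff2_diff_Y: "coeff2 (series (diff_Y h)) a b = of_nat (Suc b) * coeff2 (series h) a (Suc b)"
  unfolding diff_Y.rep_eq coeff2_def fps_deriv_nth Suc_eq_plus1[symmetric]
    fps_of_nat[symmetric] fps_mult_left_const_nth ..

text \<open>\<open>diff_X\<close> acts on the coefficients of the powers of Y, so the product rule
  in X is applied to each term of the Cauchy product in Y.\<close>

lemma diff_X_mult: "diff_X (g * h) = diff_X g * h + g * diff_X h"
  by transfer (simp add: fps_eq_iff[where 'a = "complex fps"] fps_mult_nth fps_deriv_sum sum.distrib add.commute)

lemma diff_Y_mult: "diff_Y (g * h) = diff_Y g * h + g * diff_Y h"
  by transfer (simp add: add.commute)

lemma fps_deriv_substitute:
  assumes "fps_nth x 0 = 0" "fps_nth y 0 = 0"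
  shows "fps_deriv (substitute h x y)
    = substitute (diff_X h) x y * fps_deriv x + substitute (diff_Y h) x y * fps_deriv y"
proof (rule fps_ext)
  fix n
  let ?c = "coeff2 (series h)"
  let ?m = "\<lambda>c a b. fps_const c * (x ^ a * y ^ b)"
  \<comment> \<open>Coefficient \<open>n\<close> of the derivative comes from coefficient
    \<open>Suc n\<close>, so the truncation at \<open>Suc n\<close> is differentiated and one bound
    drops to \<open>n\<close>. Terms with exponent 0 carry the factor 0, so the truncated
    subtraction in \<open>a - 1\<close> and \<open>b - 1\<close> is harmless.\<close>
  let ?TX = "truncated_substitute n (Suc n) (diff_X h) x y"
  let ?TY = "truncated_substitute (Suc n) n (diff_Y h) x y"
  have deriv: "fps_deriv (?m c a b)
      = ?m (of_nat a * c) (a - 1) b * fps_deriv x + ?m (of_nat b * c) a (b - 1) * fps_deriv y" for c a b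
    by (simp add: fps_deriv_power fps_of_nat algebra_simps flip: fps_const_mult)
  have X: "(\<Sum>a\<le>Suc n. \<Sum>b\<le>Suc n. ?m (of_nat a * ?c a b) (a - 1) b) = ?TX"
    unfolding truncated_substitute_def coeff2_diff_X
    by (subst sum.atMost_Suc_shift) simp
  have Y: "(\<Sum>a\<le>Suc n. \<Sum>b\<le>Suc n. ?m (of_nat b * ?c a b) a (b - 1)) = ?TY"
    unfolding truncated_substitute_def coeff2_diff_Y
    by (rule sum.cong[OF refl], subst sum.atMost_Suc_shift) simp
  have "fps_nth (fps_deriv (substitute h x y)) n
      = fps_nth (fps_deriv (truncated_substitute (Suc n) (Suc n) h x y)) n"
    by (simp add: substitute_nth_truncated[OF assms, of _ "Suc n" "Suc n"])
  also have "fps_deriv (truncated_substitute (Suc n) (Suc n) h x y)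
      = ?TX * fps_deriv x + ?TY * fps_deriv y"
    unfolding X[symmetric] Y[symmetric]
    unfolding truncated_substitute_def fps_deriv_sum deriv sum.distrib sum_distrib_right ..
  also have "fps_nth \<dots> n = fps_nth (substitute (diff_X h) x y * fps_deriv x
      + substitute (diff_Y h) x y * fps_deriv y) n"
    unfolding fps_add_nth fps_mult_nth
    by (intro sum.cong refl arg_cong2[of _ _ _ _ "(*)"] arg_cong2[of _ _ _ _ "(+)"]
        substitute_nth_truncated[symmetric] assms) auto
  finally show "fps_nth (fps_deriv (substitute h x y)) n
      = fps_nth (substitute (diff_X h) x y * fps_deriv x + substitute (diff_Y h) x y * fps_deriv y) n" .
qed

subsection \<open>The two embeddings into the total ring of fractions\<close>

lemma induced_eq:
  assumes "a \<in> c" "\<And>b. b \<in> c \<Longrightarrow> \<phi> b = \<phi> a"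
  shows "induced \<phi> c = \<phi> a"
proof -
  have "\<phi> ` c = {\<phi> a}" using assms by blast
  then show ?thesis by (simp add: induced_def)
qed

lemma mem_principal_ideal_iff: "h \<in> principal_ideal f \<longleftrightarrow> f dvd h"
  by (auto simp: principal_ideal_def dvd_def mult.commute)

lemma class_O_eq_0_iff: "class_O f h = class_O f 0 \<longleftrightarrow> f dvd h"
  unfolding class_O_def mem_principal_ideal_iff set_eq_iff mem_Collect_eq
  by (metis diff_0_right diff_self dvd_0_right dvd_diff_commute dvd_diff_left_iff)

lemma zero_in_F_sub: "0 \<in> F_sub f"
  unfolding F_sub_def
  by (intro CollectI exI[of _ 0]) (simp add: smult_form_def prod_eq_iff)

lemma self_in_class_Omega: "\<omega> \<in> class_Omega f \<omega>"
  by (simp add: class_Omega_def zero_in_F_sub)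

lemma self_in_bar: "\<omega> \<in> bar f \<omega>"
proof -
  have "regular_mod f 1" "smult_form 1 0 = 0"
    by (simp_all add: regular_mod_def smult_form_def prod_eq_iff)
  then have "class_Omega f 0 \<in> torsion f"
    unfolding torsion_def by (intro CollectI exI[of _ 0] exI[of _ 1] conjI refl) simp_all
  then show ?thesis by (simp add: bar_def)
qed

lemma pullback_diff: "pullback x y (\<omega> - \<eta>) = pullback x y \<omega> - pullback x y \<eta>"
  unfolding pullback_def fps_to_fls_minus[symmetric] fst_diff snd_diff substitute_diff
  by (simp only: algebra_simps)

lemma pullback_add: "pullback x y (\<omega> + \<eta>) = pullback x y \<omega> + pullback x y \<eta>"
  unfolding pullback_def fps_to_fls_plus[symmetric] fst_add snd_add substitute_add
  by (simp only: algebra_simps)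

lemma pullback_smult_form:
  assumes "fps_nth x 0 = 0" "fps_nth y 0 = 0"
  shows "pullback x y (smult_form h \<omega>) = fps_to_fls (substitute h x y) * pullback x y \<omega>"
  unfolding pullback_def smult_form_def fls_times_fps_to_fls[symmetric]
  by (simp add: substitute_mult[OF assms] algebra_simps)

section \<open>Nonvanishing of the gradient and of the parametrization\<close>

lemma not_dvd_gradient:
  assumes "h \<noteq> 0" "coeff2 (series h) 0 0 = 0"
  shows "\<not> (h dvd diff_X h \<and> h dvd diff_Y h)"
proof
  assume dvd: "h dvd diff_X h \<and> h dvd diff_Y h"
  \<comment> \<open>A nonzero coefficient of least total degree is chosen. Differentiating in a
    variable of its monomial leaves, in characteristic zero, a nonzero coefficient one degree lower,
    whereas every multiple of \<open>h\<close> starts in degree \<open>a + b\<close> or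
    higher.\<close>
  let ?P = "\<lambda>n. \<exists>a b. n = a + b \<and> coeff2 (series h) a b \<noteq> 0"
  have "\<exists>n. ?P n"
    using assms(1) by (force simp: series_inject[symmetric] zero_cps2.rep_eq fps_eq_iff coeff2_def)
  then have "?P (LEAST n. ?P n)" by (rule LeastI_ex)
  then obtain a b where ab: "(LEAST n. ?P n) = a + b" "coeff2 (series h) a b \<noteq> 0" by blast
  have low: "coeff2 (series h) a' b' = 0" if "a' + b' < a + b" for a' b'
    using not_less_Least[of "a' + b'" ?P] that ab(1) by auto
  have low_mult: "coeff2 (series g) a' b' = 0" if "h dvd g" "a' + b' < a + b" for g a' b'
  proof -
    obtain k where "g = k * h" using \<open>h dvd g\<close> by (auto simp: dvd_def mult.commute)
    then show ?thesis
      using that(2) by (auto simp: times_cps2.rep_eq coeff2_mult intro!: sum.neutral low)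
  qed
  have "a \<noteq> 0 \<or> b \<noteq> 0" using ab(2) assms(2) by metis
  then show False
  proof
    assume "a \<noteq> 0"
    then have "coeff2 (series (diff_X h)) (a - 1) b \<noteq> 0"
      using ab(2) by (simp add: coeff2_diff_X)
    then show False using low_mult[of "diff_X h" "a - 1" b] dvd \<open>a \<noteq> 0\<close> by auto
  next
    assume "b \<noteq> 0"
    then have "coeff2 (series (diff_Y h)) a (b - 1) \<noteq> 0"
      using ab(2) by (simp add: coeff2_diff_Y)
    then show False using low_mult[of "diff_Y h" a "b - 1"] dvd \<open>b \<noteq> 0\<close> by auto
  qed
qed

text \<open>At the origin substitution yields only constants, whose quotients are constants again;
  but \<open>fps_X\<close> has to lie in the fraction field.\<close>

lemma normalization_by_nonzero:
  assumes "normalization_by f x y"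
  shows "x \<noteq> 0 \<or> y \<noteq> 0"
proof (rule ccontr)
  assume *: "\<not> (x \<noteq> 0 \<or> y \<noteq> 0)"
  define R where "R = range (\<lambda>h. fps_to_fls (substitute h x y))"
  have "{z \<in> fraction_field_in R. integral_over R z} = fps_to_fls ` convergent_series"
    using assms by (simp add: normalization_by_def R_def Let_def)
  moreover have "fps_X \<in> convergent_series" by (simp add: convergent_series_def)
  ultimately have "fps_to_fls fps_X \<in> fraction_field_in R" by blast
  then obtain g h where "fps_to_fls fps_X
      = fps_to_fls (substitute g x y) / fps_to_fls (substitute h x y)" "substitute h x y \<noteq> 0"
    by (auto simp: fraction_field_in_def R_def)
  then have "fps_to_fls (fps_X * substitute h x y) = fps_to_fls (substitute g x y)"
    by (simp add: fls_times_fps_to_fls field_simps del: fps_X_to_fls)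
  then have "fps_X * substitute h 0 0 = substitute g 0 0" "substitute h 0 0 \<noteq> 0"
    using * \<open>substitute h x y \<noteq> 0\<close> by auto
  then show False
    unfolding substitute_0_0 by (auto simp: fps_eq_iff[of "_ * _"] dest!: spec[of _ 1])
qed

section \<open>Both embeddings on a single branch\<close>

locale branch =
  fixes f F G :: cps2 and x y :: "complex fps"
  assumes f_eq: "f = F * G"
    and irreducible: "irreducible F"
    and not_dvd: "\<not> F dvd G"
    and normalization: "normalization_by F x y"
begin

lemma nth_0: "fps_nth x 0 = 0" "fps_nth y 0 = 0"
  using normalization by (auto simp: normalization_by_def)

lemma substitute_eq_0_iff: "substitute h x y = 0 \<longleftrightarrow> F dvd h"
proof -
  have "{h. substitute h x y = 0} = principal_ideal F"
    using normalization by (simp add: normalization_by_def)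
  then show ?thesis by (auto simp: set_eq_iff mem_principal_ideal_iff)
qed

lemma substitute_f: "substitute f x y = 0"
  by (simp add: substitute_eq_0_iff f_eq)

lemma induced_class_O:
  "induced (\<lambda>h. fps_to_fls (substitute h x y)) (class_O f h) = fps_to_fls (substitute h x y)"
proof (rule induced_eq)
  show "h \<in> class_O f h" by (simp add: class_O_def mem_principal_ideal_iff)
  fix g assume "g \<in> class_O f h"
  then have "F dvd g - h"
    by (auto simp: class_O_def mem_principal_ideal_iff f_eq dest: dvd_mult_left)
  then show "fps_to_fls (substitute g x y) = fps_to_fls (substitute h x y)"
    by (simp add: substitute_diff flip: substitute_eq_0_iff)
qed

text \<open>If \<open>h\<close> vanished on the branch, \<open>h * G\<close> would be a multiple of
  \<open>f\<close> although \<open>G\<close> is not one.\<close>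

lemma regular_mod_substitute_nonzero:
  assumes "regular_mod f h"
  shows "substitute h x y \<noteq> 0"
proof
  assume "substitute h x y = 0"
  then have "f dvd h * G" by (simp add: substitute_eq_0_iff f_eq mult_dvd_mono)
  then have "f dvd G" using assms unfolding regular_mod_def class_O_eq_0_iff by blast
  then show False using not_dvd unfolding f_eq by (blast dest: dvd_mult_left)
qed

lemma tangent:
  "substitute (diff_X f) x y * fps_deriv x + substitute (diff_Y f) x y * fps_deriv y = 0"
  using fps_deriv_substitute[OF nth_0, of f] by (simp add: substitute_f)

text \<open>Multiples of the total differential vanish by \<open>tangent\<close>, and multiples of
  \<open>f\<close> vanish because \<open>f\<close> is zero on the branch.\<close>

lemma pullback_F_sub:
  assumes "\<eta> \<in> F_sub f"
  shows "pullback x y \<eta> = 0"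
proof -
  have "pullback x y (total_diff f) = 0"
    unfolding pullback_def total_diff_def fst_conv snd_conv tangent by simp
  with assms show ?thesis
    by (auto simp: F_sub_def pullback_add pullback_smult_form[OF nth_0] substitute_f)
qed

lemma pullback_cong_class_Omega:
  assumes "class_Omega f \<omega> = class_Omega f \<eta>"
  shows "pullback x y \<omega> = pullback x y \<eta>"
proof -
  have "\<omega> - \<eta> \<in> F_sub f" using self_in_class_Omega[of \<omega> f] unfolding assms by (simp add: class_Omega_def)
  from pullback_F_sub[OF this] show ?thesis by (simp add: pullback_diff)
qed

text \<open>Pullback kills torsion: a regular annihilator becomes a nonzero element of a field.
  Hence pullback is constant on each class.\<close>

lemma induced_bar: "induced (pullback x y) (bar f \<omega>) = pullback x y \<omega>"
proof (rule induced_eq[OF self_in_bar])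
  fix \<eta> assume "\<eta> \<in> bar f \<omega>"
  then obtain \<theta> h where *: "class_Omega f (\<eta> - \<omega>) = class_Omega f \<theta>" "regular_mod f h"
      "class_Omega f (smult_form h \<theta>) = class_Omega f 0"
    by (auto simp: bar_def torsion_def)
  have "fps_to_fls (substitute h x y) * pullback x y \<theta> = pullback x y 0"
    using pullback_cong_class_Omega[OF *(3)] by (simp add: pullback_smult_form[OF nth_0])
  then have "pullback x y \<theta> = 0"
    using regular_mod_substitute_nonzero[OF *(2)] by (simp add: pullback_def)
  then show "pullback x y \<eta> = pullback x y \<omega>"
    using pullback_cong_class_Omega[OF *(1)] by (simp add: pullback_diff)
qed

text \<open>Since \<open>F\<close> is zero on the branch, the product rule leaves \<open>G\<close>
  times the gradient of \<open>F\<close>; \<open>G\<close> is nonzero there and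
  \<open>not_dvd_gradient\<close> applies to \<open>F\<close>.\<close>

lemma gradient_nonzero: "substitute (diff_X f) x y \<noteq> 0 \<or> substitute (diff_Y f) x y \<noteq> 0"
proof -
  have "F dvd F" by simp
  then have F: "substitute F x y = 0" by (simp only: substitute_eq_0_iff)
  have "coeff2 (series F) 0 0 = 0" using substitute_nth_0[of F x y] F by simp
  then have "\<not> (F dvd diff_X F \<and> F dvd diff_Y F)"
    using irreducible by (intro not_dvd_gradient) auto
  then show ?thesis
    using not_dvd F
    by (auto simp: f_eq diff_X_mult diff_Y_mult substitute_add substitute_mult[OF nth_0]
        simp flip: substitute_eq_0_iff)
qed

lemma wedge_quot_eq_pullback:
  obtains c where "c \<noteq> 0"
    and "\<And>\<omega>. fps_to_fls (substitute (wedge_quot \<omega> f) x y) = c * pullback x y \<omega>"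
proof -
  let ?D = "substitute (diff_X f) x y" and ?E = "substitute (diff_Y f) x y"
  have wedge: "substitute (wedge_quot \<omega> f) x y = substitute (fst \<omega>) x y * ?E - substitute (snd \<omega>) x y * ?D" for \<omega>
    by (simp add: wedge_quot_def substitute_diff substitute_mult[OF nth_0])
  \<comment> \<open>The denominator of the constant receives an extra \<open>fps_X\<close> to cancel
    the one built into \<open>pullback\<close>.\<close>
  have eq: "fps_to_fls s = fps_to_fls e / fps_to_fls (fps_X * d) * fps_to_fls (fps_X * p)"
    if "d \<noteq> 0" "s * d = e * p" for s d e p :: "complex fps"
  proof -
    have "fps_to_fls s * fps_to_fls d = fps_to_fls e * fps_to_fls p"
      using that(2) by (simp flip: fls_times_fps_to_fls)
    then show ?thesis using that(1) by (simp add: fls_times_fps_to_fls field_simps)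
  qed
  have "fps_deriv x \<noteq> 0 \<or> fps_deriv y \<noteq> 0"
    using normalization_by_nonzero[OF normalization] nth_0 by (auto simp: fps_deriv_eq_0_iff)
  then show thesis
  proof
    assume x: "fps_deriv x \<noteq> 0"
    show thesis
    proof (rule that)
      \<comment> \<open>If \<open>?E\<close> were zero, \<open>tangent\<close> would force
        \<open>?D\<close> to be zero too, against \<open>gradient_nonzero\<close>.\<close>
      have "?E \<noteq> 0" using tangent gradient_nonzero x by auto
      then show "fps_to_fls ?E / fps_to_fls (fps_X * fps_deriv x) \<noteq> 0" using x by simp
      fix \<omega>
      show "fps_to_fls (substitute (wedge_quot \<omega> f) x y)
          = fps_to_fls ?E / fps_to_fls (fps_X * fps_deriv x) * pullback x y \<omega>"
        \<comment> \<open>With A, B the components of the form, \<open>tangent\<close> turns (A E -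
          B D) x' into E (A x' + B y').\<close>
        unfolding pullback_def by (rule eq[OF x]) (use tangent wedge[of \<omega>] in algebra)
    qed
  next
    assume y: "fps_deriv y \<noteq> 0"
    show thesis
    proof (rule that)
      have "?D \<noteq> 0" using tangent gradient_nonzero y by auto
      then show "fps_to_fls (- ?D) / fps_to_fls (fps_X * fps_deriv y) \<noteq> 0" using y by simp
      fix \<omega>
      show "fps_to_fls (substitute (wedge_quot \<omega> f) x y)
          = fps_to_fls (- ?D) / fps_to_fls (fps_X * fps_deriv y) * pullback x y \<omega>"
        unfolding pullback_def by (rule eq[OF y]) (use tangent wedge[of \<omega>] in algebra)
    qed
  qed
qed

end

text \<open>The choice \<open>G = 1\<close> treats the branch as a curve of its own. It gives the
  kernel of substitution before the other factors are known to be prime to \<open>F\<close>, and it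
  evaluates \<open>Lambda\<close>, whose classes are taken with respect to the branch.\<close>

lemma irreducible_branch:
  assumes "irreducible F" "normalization_by F x y"
  shows "branch F F 1 x y"
  using assms by unfold_locales (auto simp: irreducible_def)

section \<open>From proportionality to sets of values\<close>

lemma t_order_mult:
  assumes "c \<noteq> 0"
  shows "t_order (c * z) = map_extended ((+) (fls_subdegree c)) (t_order z)"
  using assms by (simp add: t_order_def)

text \<open>The rotation of (A, B) into (B, -A) is a bijection on forms, so the Jacobian ideal is
  parametrized by forms through the wedge product.\<close>

lemma Jac_eq: "Jac f = range (\<lambda>\<omega>. class_O f (wedge_quot \<omega> f))"
proof -
  have "class_O f (A * diff_X f + B * diff_Y f) = class_O f (wedge_quot (B, - A) f)" for A B
    by (simp add: wedge_quot_def add.commute)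
  moreover have "class_O f (wedge_quot \<omega> f) = class_O f (- snd \<omega> * diff_X f + fst \<omega> * diff_Y f)" for \<omega>
    by (simp add: wedge_quot_def)
  ultimately show ?thesis unfolding Jac_def by blast
qed

theorem theorem5p1:
  fixes r i :: nat and f :: cps2 and F :: "nat \<Rightarrow> cps2" and x y :: "nat \<Rightarrow> complex fps"
  assumes "r > 1"
    and "f = (\<Prod>j\<in>{1..r}. F j)"
    and "\<forall>j\<in>{1..r}. irreducible (F j)"
    and "\<forall>j\<in>{1..r}. \<forall>k\<in>{1..r}. j \<noteq> k \<longrightarrow> principal_ideal (F j) \<noteq> principal_ideal (F k)"
    and "\<forall>j\<in>{1..r}. normalization_by (F j) (x j) (y j)"
    and "1 < i" and "i \<le> r"
  shows "(\<lambda>z. t_order (emb_O x y z i)) ` N_sub f x y {1..<i} =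
           {t_order (emb_O x y (class_O f (wedge_quot \<omega> f)) i) |\<omega>. bar f \<omega> \<in> S_sub f x y {1..<i}}
       \<and> Delta f x y i - (\<lambda>z. t_order (emb_O x y z i)) ` N_sub f x y {1..<i} \<approx>
         Lambda (F i) (x i) (y i) - (\<lambda>c. t_order (emb_Omega x y c i)) ` S_sub f x y {1..<i}"
proof -
  let ?N = "(\<lambda>z. t_order (emb_O x y z i)) ` N_sub f x y {1..<i}"
  let ?W = "{t_order (emb_O x y (class_O f (wedge_quot \<omega> f)) i) |\<omega>. bar f \<omega> \<in> S_sub f x y {1..<i}}"
  let ?S = "(\<lambda>c. t_order (emb_Omega x y c i)) ` S_sub f x y {1..<i}"
  have branch: "branch f (F j) (\<Prod>k\<in>{1..r} - {j}. F k) (x j) (y j)" if j: "j \<in> {1..r}" for j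
  proof
    show "f = F j * (\<Prod>k\<in>{1..r} - {j}. F k)" using j assms(2) by (simp add: prod.remove)
    show "irreducible (F j)" "normalization_by (F j) (x j) (y j)" using j assms by auto
    then interpret one: branch "F j" "F j" 1 "x j" "y j"
      by (rule irreducible_branch)
    \<comment> \<open>Divisibility between two irreducible factors would make them associates, so
      their ideals would coincide.\<close>
    have "substitute (F k) (x j) (y j) \<noteq> 0" if k: "k \<in> {1..r} - {j}" for k
    proof
      assume "substitute (F k) (x j) (y j) = 0"
      then obtain u where u: "F k = F j * u" by (auto simp: one.substitute_eq_0_iff)
      have "irreducible (F k)" using k assms(3) by blast
      then have "u dvd 1" using u one.irreducible by (auto simp: irreducible_def)
      then have "F k dvd F j" unfolding u by (simp add: mult_unit_dvd_iff)
      moreover have "F j dvd F k" by (simp add: u)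
      ultimately have "principal_ideal (F j) = principal_ideal (F k)"
        unfolding set_eq_iff mem_principal_ideal_iff using dvd_trans by blast
      then show False using assms(4)[rule_format, OF j, of k] k by simp
    qed
    \<comment> \<open>\<open>F j\<close> acts as a prime because it generates the kernel of a
      homomorphism into a domain, where a product of nonzero factors is nonzero.\<close>
    then have "substitute (\<Prod>k\<in>{1..r} - {j}. F k) (x j) (y j) \<noteq> 0"
      unfolding substitute_prod[OF one.nth_0] by simp
    then show "\<not> F j dvd (\<Prod>k\<in>{1..r} - {j}. F k)" by (simp add: one.substitute_eq_0_iff)
  qed
  have i: "i \<in> {1..r}" and less: "\<And>l. l \<in> {1..<i} \<Longrightarrow> l \<in> {1..r}" using assms by auto
  have emb_O: "emb_O x y (class_O f h) j = fps_to_fls (substitute h (x j) (y j))"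
    if "j \<in> {1..r}" for h j
    unfolding emb_O_def by (rule branch.induced_class_O[OF branch[OF that]])
  have emb_Omega: "emb_Omega x y (bar f \<omega>) j = pullback (x j) (y j) \<omega>" if "j \<in> {1..r}" for \<omega> j
    unfolding emb_Omega_def by (rule branch.induced_bar[OF branch[OF that]])
  have vanish: "emb_O x y (class_O f (wedge_quot \<omega> f)) l = 0 \<longleftrightarrow> emb_Omega x y (bar f \<omega>) l = 0"
    if l: "l \<in> {1..r}" for \<omega> l
  proof -
    obtain c where "c \<noteq> 0"
      "\<And>\<omega>. fps_to_fls (substitute (wedge_quot \<omega> f) (x l) (y l)) = c * pullback (x l) (y l) \<omega>"
      using branch.wedge_quot_eq_pullback[OF branch[OF l]] by blast
    then show ?thesis unfolding emb_O[OF l] emb_Omega[OF l] by simp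
  qed
  have S: "bar f \<omega> \<in> S_sub f x y {1..<i} \<longleftrightarrow> (\<forall>l\<in>{1..<i}. emb_Omega x y (bar f \<omega>) l = 0)" for \<omega>
    by (auto simp: S_sub_def S_branch_def Omega_mod_torsion_def)
  have "(\<forall>l\<in>{1..<i}. emb_O x y (class_O f (wedge_quot \<omega> f)) l = 0)
      \<longleftrightarrow> bar f \<omega> \<in> S_sub f x y {1..<i}" for \<omega>
    unfolding S using vanish[OF less] by simp
  then have "N_sub f x y {1..<i}
      = {class_O f (wedge_quot \<omega> f) |\<omega>. bar f \<omega> \<in> S_sub f x y {1..<i}}"
    unfolding N_sub_def Jac_eq by blast
  then have N: "?N = ?W" by (simp only: setcompr_eq_image image_image)
  obtain c where c: "c \<noteq> 0"
    "\<And>\<omega>. fps_to_fls (substitute (wedge_quot \<omega> f) (x i) (y i)) = c * pullback (x i) (y i) \<omega>"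
    using branch.wedge_quot_eq_pullback[OF branch[OF i]] by blast
  \<comment> \<open>\<open>map_extended\<close> fixes infinity, so forms with zero pullback are
    covered as well.\<close>
  define shift where "shift = map_extended ((+) (fls_subdegree c))"
  have shift: "t_order (emb_O x y (class_O f (wedge_quot \<omega> f)) i)
      = shift (t_order (pullback (x i) (y i) \<omega>))" for \<omega>
    by (simp add: emb_O[OF i] c t_order_mult shift_def)
  have "inj shift" unfolding shift_def by (intro extended.inj_map) simp
  interpret one: branch "F i" "F i" 1 "x i" "y i"
    using assms(3,5) i by (intro irreducible_branch) auto
  \<comment> \<open>The classes in \<open>Lambda\<close> are taken with respect to
    \<open>F i\<close>, those in \<open>emb_Omega\<close> with respect to \<open>f\<close>; both are
    evaluated by the same pullback.\<close>
  have "Delta f x y i = shift ` Lambda (F i) (x i) (y i)"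
    unfolding Delta_def Lambda_def Jac_eq Omega_mod_torsion_def image_image shift one.induced_bar ..
  \<comment> \<open>An intersection over no index would be the whole type. Because
    \<open>1 < i\<close>, the index 1 occurs, so every member is the class of a form.\<close>
  moreover have "S_sub f x y {1..<i} \<subseteq> S_branch f x y 1"
    unfolding S_sub_def using assms(6) by (intro INF_lower) simp
  then have "S_sub f x y {1..<i} = bar f ` {\<omega>. bar f \<omega> \<in> S_sub f x y {1..<i}}"
    unfolding S_branch_def Omega_mod_torsion_def by blast
  then have "?S = (\<lambda>c. t_order (emb_Omega x y c i)) ` bar f ` {\<omega>. bar f \<omega> \<in> S_sub f x y {1..<i}}"
    by (rule arg_cong)
  then have "?S = (\<lambda>\<omega>. t_order (pullback (x i) (y i) \<omega>)) ` {\<omega>. bar f \<omega> \<in> S_sub f x y {1..<i}}"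
    by (simp only: image_image emb_Omega[OF i])
  then have "?N = shift ` ?S" unfolding N shift by (simp only: setcompr_eq_image image_image)
  ultimately have "Delta f x y i - ?N = shift ` (Lambda (F i) (x i) (y i) - ?S)"
    using \<open>inj shift\<close> by (simp add: image_set_diff)
  then have "Delta f x y i - ?N \<approx> Lambda (F i) (x i) (y i) - ?S"
    using inj_on_image_eqpoll_self[OF inj_on_subset[OF \<open>inj shift\<close> subset_UNIV]] by metis
  with N show ?thesis by blast
qed

end
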